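(* Let $F$ be the face $(\mathcal W_2^{12},U_{2,3}^{134})$ of $\Gamma_4$. For real $a,b\ge0$, the point $\mathbf h=(a,b)\in F$ is entropic if and only if there exist an integer $v\ge1$ and a partition $(\alpha_0,\alpha_1,\dots,\alpha_{t-1})$ of $v$ such that $a+b=\log v$ and $a=H\left(\frac{\alpha_0}{v},\frac{\alpha_1}{v},\dots,\frac{\alpha_{t-1}}{v}\right)$.
   Context: $N_4=\{1,2,3,4\}$. $\Gamma_4$ is the cone of all polymatroid rank functions on $N_4$. A set function $\mathbf h:2^{N_4}\to\mathbb R$ is called entropic if there is a random vector $(X_1,X_2,X_3,X_4)$, each $X_i$ taking values in a finite set, with $\mathbf h(A)=H(X_A)$ for all $A\subseteq N_4$, where $H$ is Shannon entropy, $X_A=(X_j,j\in A)$ and $\mathbf h(\emptyset)=0$. Logarithms (also in the entropy) are to base $2$. For a probability vector $(q_0,\dots,q_{t-1})$, $H(q_0,\dots,q_{t-1})=-\sum_i q_i\log q_i$. For two (poly)matroids $M_1,M_2$ on $N_4$ with rank functions $\mathbf r_1,\mathbf r_2$, $(M_1,M_2)$ denotes the face $\{a\mathbf r_1+b\mathbf r_2:a,b\ge0\}$ of $\Gamma_4$, and $(a,b)$ denotes the point $a\mathbf r_1+b\mathbf r_2$. $\mathcal W_2^{12}$ is the matroid on $N_4$ with $\mathbf r(\emptyset)=0$, $\mathbf r(A)=1$ if $|A|=1$ or $A=\{1,2\}$, and $\mathbf r(A)=2$ otherwise. $U^{134}_{2,3}$ is the matroid on $N_4$ with rank function $\mathbf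 r(A)=\min\{2,|A\cap\{1,3,4\}|\}$. A partition of a positive integer $v$ is a tuple $(\alpha_0,\dots,\alpha_{t-1})$, $1\le t\le v$, of positive integers with $\sum_{i=0}^{t-1}\alpha_i=v$. *)

theory Defs
  imports "HOL-Probability.Probability"
begin

definition N4 :: "nat set" where
  "N4 = {1, 2, 3, 4}"

text \<open>
  Set functions on \<open>N4\<close> are functions \<open>nat set \<Rightarrow> real\<close>; only their values on subsets of \<open>N4\<close> matter.
\<close>

definition W2_rank :: "nat set \<Rightarrow> real" where
  "W2_rank A = (if A = {} then 0 else if card A = 1 \<or> A = {1, 2} then 1 else 2)"

definition U23_rank :: "nat set \<Rightarrow> real" where
  "U23_rank A = min 2 (real (card (A \<inter> {1, 3, 4})))"

definition face_point ::
  "(nat set \<Rightarrow> real) \<Rightarrow> (nat set \<Rightarrow> real) \<Rightarrow> real \<Rightarrow> real \<Rightarrow> nat set \<Rightarrow> real" where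
  "face_point r1 r2 a b = (\<lambda>A. a * r1 A + b * r2 A)"

text \<open>
  The joint variable \<open>X\<^sub>A\<close> is the tuple \<open>(X j \<omega>)\<close> for \<open>j \<in> A\<close>, as a function restricted to \<open>A\<close>.
  The measure \<open>count_space (X\<^sub>A ` space M)\<close> is the reference measure for which the library's
  \<open>entropy\<close> is the Shannon entropy of a variable with finite range.
\<close>

definition joint_entropy :: "'s measure \<Rightarrow> (nat \<Rightarrow> 's \<Rightarrow> 'v) \<Rightarrow> nat set \<Rightarrow> real" where
  "joint_entropy M X A =
     prob_space.entropy M 2 (count_space ((\<lambda>\<omega>. \<lambda>j\<in>A. X j \<omega>) ` space M)) (\<lambda>\<omega>. \<lambda>j\<in>A. X j \<omega>)"

text \<open>
  A definition cannot quantify over types, so the sample space and the finite value sets are taken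
  inside \<open>nat\<close>. Lemma \<open>entropicI\<close> below shows that this loses no generality.
\<close>

definition entropic :: "(nat set \<Rightarrow> real) \<Rightarrow> bool" where
  "entropic h \<longleftrightarrow>
     (\<exists>(M :: nat measure) (X :: nat \<Rightarrow> nat \<Rightarrow> nat).
        prob_space M \<and> (\<forall>j\<in>N4. simple_function M (X j)) \<and>
        (\<forall>A\<subseteq>N4. h A = joint_entropy M X A))"

definition prob_entropy :: "real list \<Rightarrow> real" where
  "prob_entropy q = - (\<Sum>i<length q. q ! i * log 2 (q ! i))"

definition int_partition :: "nat \<Rightarrow> nat list \<Rightarrow> bool" where
  "int_partition v \<alpha> \<longleftrightarrow>
     1 \<le> length \<alpha> \<and> length \<alpha> \<le> v \<and> (\<forall>x\<in>set \<alpha>. 0 < x) \<and> sum_list \<alpha> = v"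

lemma simple_function_restrict:
  assumes "finite A" "\<And>j. j \<in> A \<Longrightarrow> simple_function M (X j)"
  shows "simple_function M (\<lambda>\<omega>. \<lambda>j\<in>A. X j \<omega>)"
  unfolding simple_function_def
proof (intro conjI ballI)
  have "(\<lambda>\<omega>. \<lambda>j\<in>A. X j \<omega>) ` space M \<subseteq> (\<Pi>\<^sub>E j\<in>A. X j ` space M)"
    by auto
  moreover have "finite (\<Pi>\<^sub>E j\<in>A. X j ` space M)"
    using assms by (intro finite_PiE) (auto simp: simple_function_def)
  ultimately show "finite ((\<lambda>\<omega>. \<lambda>j\<in>A. X j \<omega>) ` space M)"
    by (rule finite_subset)
next
  fix x assume "x \<in> (\<lambda>\<omega>. \<lambda>j\<in>A. X j \<omega>) ` space M"
  then have x: "x \<in> extensional A" by auto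
  have "(\<lambda>\<omega>. \<lambda>j\<in>A. X j \<omega>) -` {x} \<inter> space M = {\<omega>\<in>space M. \<forall>j\<in>A. X j \<omega> = x j}"
    using x by (auto simp: fun_eq_iff extensional_def)
  also have "\<dots> \<in> sets M"
    using assms(1)
  proof (intro sets.sets_Collect_finite_All)
    fix j assume "j \<in> A"
    then have "X j -` {x j} \<inter> space M \<in> sets M"
      by (intro simple_functionD assms)
    then show "{\<omega> \<in> space M. X j \<omega> = x j} \<in> sets M"
      by (simp add: vimage_def Int_def conj_commute)
  qed
  finally show "(\<lambda>\<omega>. \<lambda>j\<in>A. X j \<omega>) -` {x} \<inter> space M \<in> sets M" .
qed

lemma entropy_eq_sum:
  assumes "prob_space M" "simple_function M X"
  shows "prob_space.entropy M 2 (count_space (X ` space M)) X =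
    - (\<Sum>x\<in>X ` space M. measure M (X -` {x} \<inter> space M) * log 2 (measure M (X -` {x} \<inter> space M)))"
proof -
  interpret prob_space M by fact
  interpret information_space M 2 by unfold_locales simp
  show ?thesis
    by (rule entropy_simple_distributed, rule simple_distributedI[OF assms(2)]) (auto simp: measure_nonneg)
qed

lemma entropicI:
  fixes M :: "'s measure" and X :: "nat \<Rightarrow> 's \<Rightarrow> 'v"
  assumes M: "prob_space M" and X: "\<And>j. j \<in> N4 \<Longrightarrow> simple_function M (X j)"
    and h: "\<And>A. A \<subseteq> N4 \<Longrightarrow> h A = joint_entropy M X A"
  shows "entropic h"
proof -
  interpret prob_space M by fact
  define T where "T = (\<lambda>\<omega>. \<lambda>j\<in>N4. X j \<omega>)"
  define V where "V = (\<Union>j\<in>N4. X j ` space M)"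
  have T: "simple_function M T"
    unfolding T_def by (rule simple_function_restrict) (auto simp: N4_def intro: X[unfolded N4_def])
  then have finT: "finite (T ` space M)" by (rule simple_functionD)
  have "finite V"
    using X by (auto simp: V_def simple_function_def) (auto simp: N4_def)
  then obtain g :: "'v \<Rightarrow> nat" where g: "inj_on g V"
    using finite_imp_inj_to_nat_seg by metis
  obtain c :: "(nat \<Rightarrow> 'v) \<Rightarrow> nat" where c: "inj_on c (T ` space M)"
    using finite_imp_inj_to_nat_seg[OF finT] by metis
  define f where "f = (\<lambda>\<omega>. c (T \<omega>))"
  define Y where "Y = (\<lambda>j n. g (inv_into (T ` space M) c n j))"
  define M' where "M' = distr M (count_space (f ` space M)) f"
  have "simple_function M f"
    using simple_function_compose[OF T, of c] by (simp add: f_def comp_def)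
  then have f: "f \<in> measurable M (count_space (f ` space M))"
    by (auto simp: measurable_count_space_eq2 simple_function_def)
  have M': "prob_space M'"
    unfolding M'_def using f by (rule prob_space_distr)
  have sp: "space M' = f ` space M" "sets M' = Pow (f ` space M)"
    by (simp_all add: M'_def)
  have fin: "finite (f ` space M)"
    using \<open>simple_function M f\<close> by (rule simple_functionD)
  have Y: "simple_function M' Z" for Z :: "nat \<Rightarrow> 'w"
    unfolding simple_function_def using fin by (auto simp: sp)
  have Yf: "Y j (f \<omega>) = g (X j \<omega>)" if "\<omega> \<in> space M" "j \<in> N4" for \<omega> j
    using that c by (simp add: Y_def f_def T_def inv_into_f_f)
  have "joint_entropy M' Y A = joint_entropy M X A" if A: "A \<subseteq> N4" for A
  proof -
    define XA where "XA = (\<lambda>\<omega>. \<lambda>j\<in>A. X j \<omega>)"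
    define YA where "YA = (\<lambda>n. \<lambda>j\<in>A. Y j n)"
    define \<phi> where "\<phi> = (\<lambda>x. \<lambda>j\<in>A. g (x j))"
    have YAf: "YA (f \<omega>) = \<phi> (XA \<omega>)" if "\<omega> \<in> space M" for \<omega>
      using that A Yf by (auto simp: YA_def \<phi>_def XA_def fun_eq_iff)
    have inj: "inj_on \<phi> (XA ` space M)"
    proof (rule inj_onI)
      fix x y assume x: "x \<in> XA ` space M" and y: "y \<in> XA ` space M" and e: "\<phi> x = \<phi> y"
      have "x j = y j" for j
      proof (cases "j \<in> A")
        case True
        then have "g (x j) = g (y j)" using fun_cong[OF e, of j] by (simp add: \<phi>_def)
        moreover have "x j \<in> V" "y j \<in> V" using x y True A by (auto simp: XA_def V_def intro!: bexI[of _ j])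
        ultimately show ?thesis using g by (auto dest: inj_onD)
      next
        case False
        then show ?thesis using x y by (auto simp: XA_def)
      qed
      then show "x = y" by auto
    qed
    have XA: "simple_function M XA"
      unfolding XA_def
      by (rule simple_function_restrict) (use A X in \<open>auto simp: N4_def intro: finite_subset\<close>)
    have img: "YA ` space M' = \<phi> ` (XA ` space M)"
      unfolding sp image_image by (rule image_cong) (auto simp: YAf)
    have pr: "measure M' (YA -` {\<phi> x} \<inter> space M') = measure M (XA -` {x} \<inter> space M)"
      if "x \<in> XA ` space M" for x
    proof -
      have "measure M' (YA -` {\<phi> x} \<inter> space M') =
          measure M (f -` (YA -` {\<phi> x} \<inter> space M') \<inter> space M)"
        unfolding M'_def using f by (subst measure_distr) auto
      also have "f -` (YA -` {\<phi> x} \<inter> space M') \<inter> space M = XA -` {x} \<inter> space M"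
      proof -
        have "YA (f \<omega>) = \<phi> x \<longleftrightarrow> XA \<omega> = x" if "\<omega> \<in> space M" for \<omega>
          using that \<open>x \<in> XA ` space M\<close> inj by (auto simp: YAf inj_on_eq_iff)
        then show ?thesis by (auto simp: sp)
      qed
      finally show ?thesis .
    qed
    have "prob_space.entropy M' 2 (count_space (YA ` space M')) YA =
        prob_space.entropy M 2 (count_space (XA ` space M)) XA"
      unfolding entropy_eq_sum[OF M XA] entropy_eq_sum[OF M' Y[of YA]]
      unfolding img sum.reindex[OF inj] by (simp add: pr cong: sum.cong)
    then show ?thesis
      by (simp add: joint_entropy_def XA_def YA_def)
  qed
  then show ?thesis
    unfolding entropic_def using M' Y h by (intro exI[of _ M'] exI[of _ Y]) auto
qed

end

theory Submission
  imports Defs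
begin

text \<open>
  On the face, \<open>X\<^sub>1\<close>, \<open>X\<^sub>3\<close>, \<open>X\<^sub>4\<close> are pairwise independent, each pair determines the third, all
  have entropy \<open>a + b\<close>, and \<open>X\<^sub>2\<close> is a function of \<open>X\<^sub>1\<close> with entropy \<open>a\<close>. Every joint outcome
  \<open>(x, y, z)\<close> that occurs then has probability \<open>P(x) P(y) = P(x) P(z) = P(y) P(z)\<close>, so its three
  marginals coincide; since every pair \<open>(x, y)\<close> occurs, all marginals are equal and \<open>X\<^sub>1\<close> is uniform
  on some \<open>v\<close> values. The level sets of \<open>X\<^sub>2\<close> as a function of \<open>X\<^sub>1\<close> form the partition of \<open>v\<close>.
  Conversely, take \<open>X\<^sub>1\<close>, \<open>X\<^sub>3\<close> independent and uniform modulo \<open>v\<close>, \<open>X\<^sub>4 = X\<^sub>1 + X\<^sub>3\<close>, and \<open>X\<^sub>2\<close> the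
  block of \<open>X\<^sub>1\<close>.
\<close>

section \<open>Entropies of functions of one finite random variable\<close>

definition fiber_mass :: "'a set \<Rightarrow> ('a \<Rightarrow> real) \<Rightarrow> ('a \<Rightarrow> 'b) \<Rightarrow> 'a \<Rightarrow> real" where
  "fiber_mass S p f s = (\<Sum>t\<in>{t\<in>S. f t = f s}. p t)"

text \<open>Entropy of \<open>f\<close> as an expectation over \<open>S\<close> rather than a sum over the values of \<open>f\<close>, so that
  entropies of different variables can be compared term by term.\<close>

definition fiber_entropy :: "'a set \<Rightarrow> ('a \<Rightarrow> real) \<Rightarrow> ('a \<Rightarrow> 'b) \<Rightarrow> real" where
  "fiber_entropy S p f = - (\<Sum>s\<in>S. p s * log 2 (fiber_mass S p f s))"

lemma fiber_mass_cong:
  assumes "\<And>t. t \<in> S \<Longrightarrow> f t = f s \<longleftrightarrow> g t = g s"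
  shows "fiber_mass S p f s = fiber_mass S p g s"
  unfolding fiber_mass_def using assms by (intro sum.cong) auto

text \<open>Entropy sees only the partition of \<open>S\<close> into fibers, not the values. This
  lets tuples such as \<open>(t 1, t 3)\<close> stand in for restrictions such as
  \<open>restrict t {1, 3}\<close>.\<close>

lemma fiber_entropy_cong:
  assumes "\<And>s t. s \<in> S \<Longrightarrow> t \<in> S \<Longrightarrow> f s = f t \<longleftrightarrow> g s = g t"
  shows "fiber_entropy S p f = fiber_entropy S p g"
  unfolding fiber_entropy_def using assms
  by (intro arg_cong[where f = uminus] sum.cong refl arg_cong2[where f = "(*)"]
      arg_cong[where f = "log 2"] fiber_mass_cong) auto

text \<open>Within one fiber of \<open>f\<close> the logarithm is constant, so the sum over values
  of \<open>f\<close> can be spread out over the outcomes of \<open>T\<close>. Outcomes of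
  probability zero contribute nothing and are dropped; the resulting index set \<open>S\<close> is
  the same for every \<open>f\<close>.\<close>

lemma entropy_compose_eq_fiber_entropy:
  fixes T :: "'s \<Rightarrow> 'a" and f :: "'a \<Rightarrow> 'b"
  assumes M: "prob_space M" and T: "simple_function M T"
  defines "p \<equiv> \<lambda>t. measure M (T -` {t} \<inter> space M)"
  defines "S \<equiv> {t \<in> T ` space M. 0 < p t}"
  shows "prob_space.entropy M 2 (count_space ((\<lambda>\<omega>. f (T \<omega>)) ` space M)) (\<lambda>\<omega>. f (T \<omega>)) =
    fiber_entropy S p f"
proof -
  interpret prob_space M by fact
  let ?Y = "\<lambda>\<omega>. f (T \<omega>)" and ?R = "T ` space M"
  have Y: "simple_function M ?Y"
    using simple_function_compose[OF T, of f] by (simp add: comp_def)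
  have fin: "finite ?R" using T by (rule simple_functionD)
  have p0: "p t = 0" if "t \<in> ?R" "t \<notin> S" for t
    using that measure_nonneg[of M "T -` {t} \<inter> space M"] by (auto simp: S_def p_def)
  have mass: "measure M (?Y -` {y} \<inter> space M) = (\<Sum>t\<in>{t\<in>?R. f t = y}. p t)" for y
  proof -
    have "?Y -` {y} \<inter> space M = (\<Union>t\<in>{t\<in>?R. f t = y}. T -` {t} \<inter> space M)" by auto
    also have "measure M \<dots> = (\<Sum>t\<in>{t\<in>?R. f t = y}. p t)"
      unfolding p_def using fin T
      by (intro finite_measure_finite_Union) (auto simp: disjoint_family_on_def simple_functionD)
    finally show ?thesis .
  qed
  have massS: "(\<Sum>t\<in>{t\<in>?R. f t = f s}. p t) = fiber_mass S p f s" for s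
    unfolding fiber_mass_def
    using fin p0 by (intro sum.mono_neutral_right) (auto simp: S_def)
  have img: "?Y ` space M = f ` ?R" by auto
  have "(\<Sum>y\<in>?Y ` space M. measure M (?Y -` {y} \<inter> space M) * log 2 (measure M (?Y -` {y} \<inter> space M)))
      = (\<Sum>y\<in>f ` ?R. \<Sum>t\<in>{t\<in>?R. f t = y}. p t * log 2 (fiber_mass S p f t))"
    unfolding img
  proof (rule sum.cong)
    fix y assume "y \<in> f ` ?R"
    then obtain s where s: "y = f s" by auto
    have "(\<Sum>t\<in>{t\<in>?R. f t = y}. p t * log 2 (fiber_mass S p f t)) =
        (\<Sum>t\<in>{t\<in>?R. f t = y}. p t * log 2 (fiber_mass S p f s))"
      by (rule sum.cong) (auto simp: fiber_mass_def s)
    also have "\<dots> = fiber_mass S p f s * log 2 (fiber_mass S p f s)"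
      unfolding s massS[symmetric] by (rule sum_distrib_right[symmetric])
    finally show "measure M (?Y -` {y} \<inter> space M) * log 2 (measure M (?Y -` {y} \<inter> space M)) =
        (\<Sum>t\<in>{t\<in>?R. f t = y}. p t * log 2 (fiber_mass S p f t))"
      unfolding mass by (simp only: s massS)
  qed simp
  also have "\<dots> = (\<Sum>t\<in>?R. p t * log 2 (fiber_mass S p f t))"
    using fin by (intro sum.group) auto
  also have "\<dots> = (\<Sum>t\<in>S. p t * log 2 (fiber_mass S p f t))"
    using fin p0 by (intro sum.mono_neutral_right) (auto simp: S_def)
  finally show ?thesis
    by (simp add: entropy_eq_sum[OF M Y] fiber_entropy_def)
qed

lemma sum_support_eq_1:
  assumes M: "prob_space M" and T: "simple_function M T"
  defines "p \<equiv> \<lambda>t. measure M (T -` {t} \<inter> space M)"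
  defines "S \<equiv> {t \<in> T ` space M. 0 < p t}"
  shows "(\<Sum>t\<in>S. p t) = 1"
proof -
  interpret prob_space M by fact
  have fin: "finite (T ` space M)" using T by (rule simple_functionD)
  have "(\<Sum>t\<in>S. p t) = (\<Sum>t\<in>T ` space M. p t)"
    using fin measure_nonneg[of M]
    by (intro sum.mono_neutral_left) (auto simp: S_def p_def not_less intro: antisym)
  also have "\<dots> = measure M (\<Union>t\<in>T ` space M. T -` {t} \<inter> space M)"
    unfolding p_def using fin T
    by (intro finite_measure_finite_Union[symmetric]) (auto simp: disjoint_family_on_def simple_functionD)
  also have "(\<Union>t\<in>T ` space M. T -` {t} \<inter> space M) = space M" by auto
  finally show ?thesis by (simp add: prob_space)
qed

section \<open>Equality cases of entropy inequalities\<close>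

text \<open>With strictly positive weights, a weighted sum of nonnegative terms vanishes only if
  every term does. An equality of entropies thus becomes a statement about each element of
  \<open>S\<close>.\<close>

locale positive_weights =
  fixes S :: "'a set" and p :: "'a \<Rightarrow> real"
  assumes finite_S: "finite S" and p_pos: "s \<in> S \<Longrightarrow> 0 < p s" and sum_p: "sum p S = 1"
begin

lemma nonempty: "S \<noteq> {}"
  using sum_p by auto

lemma fiber_mass_pos: "s \<in> S \<Longrightarrow> 0 < fiber_mass S p f s"
  unfolding fiber_mass_def using finite_S p_pos by (intro sum_pos) auto

lemma fiber_mass_strict_mono:
  assumes "s \<in> S" "t \<in> S" "f t = f s" "g t \<noteq> g s"
    and "\<And>u. u \<in> S \<Longrightarrow> g u = g s \<Longrightarrow> f u = f s"
  shows "fiber_mass S p g s < fiber_mass S p f s"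
  unfolding fiber_mass_def
proof (rule sum_strict_mono2[where b = t])
  show "{t \<in> S. g t = g s} \<subseteq> {t \<in> S. f t = f s}"
    using assms(5) by blast
  show "t \<in> {t \<in> S. f t = f s} - {t \<in> S. g t = g s}"
    using assms(2-4) by simp
qed (use finite_S p_pos assms(2) in \<open>auto intro: less_imp_le\<close>)

lemma sum_over_fibers:
  "(\<Sum>s\<in>S. p s * \<phi> (f s)) = (\<Sum>x\<in>f ` S. (\<Sum>t\<in>{t\<in>S. f t = x}. p t) * \<phi> x)"
proof -
  have "(\<Sum>s\<in>S. p s * \<phi> (f s)) = (\<Sum>x\<in>f ` S. \<Sum>t\<in>{t\<in>S. f t = x}. p t * \<phi> (f t))"
    using finite_S by (intro sum.group[symmetric]) auto
  also have "\<dots> = (\<Sum>x\<in>f ` S. \<Sum>t\<in>{t\<in>S. f t = x}. p t * \<phi> x)"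
    by (intro sum.cong) auto
  finally show ?thesis by (simp only: sum_distrib_right)
qed

text \<open>The entropy difference is the expectation of the log ratio of the two masses. Each ratio
  is at least 1 because \<open>g\<close>-fibers lie inside \<open>f\<close>-fibers, so a zero
  difference makes every ratio equal to 1.\<close>

lemma fiber_mass_eq_of_entropy_eq:
  assumes refine: "\<And>s t. s \<in> S \<Longrightarrow> t \<in> S \<Longrightarrow> g s = g t \<Longrightarrow> f s = f t"
    and eq: "fiber_entropy S p g = fiber_entropy S p f" and s: "s \<in> S"
  shows "fiber_mass S p g s = fiber_mass S p f s"
proof -
  let ?d = "\<lambda>s. p s * (log 2 (fiber_mass S p f s) - log 2 (fiber_mass S p g s))"
  have le: "fiber_mass S p g s \<le> fiber_mass S p f s" if "s \<in> S" for s
    unfolding fiber_mass_def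
  proof (rule sum_mono2)
    show "{t \<in> S. g t = g s} \<subseteq> {t \<in> S. f t = f s}"
      using refine that by blast
  qed (use finite_S p_pos in \<open>auto intro: less_imp_le\<close>)
  have "0 \<le> ?d t" if "t \<in> S" for t
    using that le[OF that] p_pos[OF that] fiber_mass_pos[OF that, of g] fiber_mass_pos[OF that, of f]
    by simp
  moreover have "sum ?d S = 0"
    using eq by (simp add: fiber_entropy_def right_diff_distrib sum_subtractf)
  ultimately have "?d s = 0"
    using finite_S s by (simp add: sum_nonneg_eq_0_iff)
  then show ?thesis
    using p_pos[OF s] fiber_mass_pos[OF s, of g] fiber_mass_pos[OF s, of f]
    by (auto simp: log_def)
qed

text \<open>This is vanishing conditional entropy: \<open>f\<close> determines \<open>g\<close> on
  \<open>S\<close>, since a \<open>g\<close>-fiber properly inside an \<open>f\<close>-fiber would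
  have strictly smaller mass.\<close>

lemma fiber_eq_of_entropy_eq:
  assumes refine: "\<And>s t. s \<in> S \<Longrightarrow> t \<in> S \<Longrightarrow> g s = g t \<Longrightarrow> f s = f t"
    and eq: "fiber_entropy S p g = fiber_entropy S p f"
    and "s \<in> S" "t \<in> S" "f s = f t"
  shows "g s = g t"
proof (rule ccontr)
  assume "g s \<noteq> g t"
  then have "fiber_mass S p g s < fiber_mass S p f s"
    using assms(3-5) by (intro fiber_mass_strict_mono[of s t, OF _ _ _ _ refine]) simp_all
  moreover have "fiber_mass S p g s = fiber_mass S p f s"
    using refine eq \<open>s \<in> S\<close> by (rule fiber_mass_eq_of_entropy_eq)
  ultimately show False by linarith
qed

text \<open>The equality case of \<open>ln z \<le> z - 1\<close>: both the logarithmic terms and the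
  total product mass of the occurring value pairs have to be extremal.\<close>

lemma
  fixes f :: "'a \<Rightarrow> 'b" and g :: "'a \<Rightarrow> 'c"
  assumes eq: "fiber_entropy S p (\<lambda>s. (f s, g s)) = fiber_entropy S p f + fiber_entropy S p g"
  shows fiber_mass_pair_eq: "s \<in> S \<Longrightarrow> fiber_mass S p (\<lambda>s. (f s, g s)) s = fiber_mass S p f s * fiber_mass S p g s"
    and fiber_pair_surj: "s \<in> S \<Longrightarrow> t \<in> S \<Longrightarrow> \<exists>u\<in>S. f u = f s \<and> g u = g t"
proof -
  let ?m = "fiber_mass S p"
  let ?fg = "\<lambda>s. (f s, g s)"
  define F where "F x = (\<Sum>t\<in>{t\<in>S. f t = x}. p t)" for x
  define G where "G x = (\<Sum>t\<in>{t\<in>S. g t = x}. p t)" for x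
  define J where "J x = (\<Sum>t\<in>{t\<in>S. ?fg t = x}. p t)" for x
  have mF: "?m f s = F (f s)" and mG: "?m g s = G (g s)" and mJ: "?m ?fg s = J (f s, g s)" for s
    by (simp_all add: fiber_mass_def F_def G_def J_def)
  \<comment> \<open>The density of the product of the marginals relative to the joint distribution.
    Its expectation is the product mass of the value pairs that occur, hence at most 1.\<close>
  define z where "z s = F (f s) * G (g s) / J (f s, g s)" for s
  have pos: "0 < F (f s)" "0 < G (g s)" "0 < J (f s, g s)" if "s \<in> S" for s
    using fiber_mass_pos[OF that, of f] fiber_mass_pos[OF that, of g] fiber_mass_pos[OF that, of ?fg]
    by (simp_all only: mF mG mJ)
  have zpos: "0 < z s" if "s \<in> S" for s using pos[OF that] by (simp add: z_def)
  have sumF: "sum F (f ` S) = 1"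
    using sum_over_fibers[of "\<lambda>_. 1" f] sum_p by (simp add: F_def)
  have sumG: "sum G (g ` S) = 1"
    using sum_over_fibers[of "\<lambda>_. 1" g] sum_p by (simp add: G_def)
  have prod1: "(\<Sum>(x,y)\<in>f ` S \<times> g ` S. F x * G y) = 1"
    using sumF sumG by (simp add: sum.cartesian_product[symmetric] sum_distrib_left[symmetric])
  have FGpos: "0 < F x * G y" if "(x, y) \<in> f ` S \<times> g ` S" for x y
    using that pos by auto
  have sub: "?fg ` S \<subseteq> f ` S \<times> g ` S" by auto
  have sumz: "(\<Sum>s\<in>S. p s * z s) = (\<Sum>(x,y)\<in>?fg ` S. F x * G y)"
  proof -
    have "(\<Sum>s\<in>S. p s * z s) = (\<Sum>s\<in>S. p s * (case ?fg s of (x, y) \<Rightarrow> F x * G y / J (x, y)))"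
      by (simp add: z_def)
    also have "\<dots> = (\<Sum>w\<in>?fg ` S. J w * (case w of (x, y) \<Rightarrow> F x * G y / J (x, y)))"
      unfolding J_def by (rule sum_over_fibers)
    also have "\<dots> = (\<Sum>(x,y)\<in>?fg ` S. F x * G y)"
      using pos by (intro sum.cong) (auto simp: less_imp_neq[symmetric])
    finally show ?thesis .
  qed
  have sumz_le: "(\<Sum>(x,y)\<in>?fg ` S. F x * G y) \<le> 1"
    unfolding prod1[symmetric] using finite_S sub FGpos
    by (intro sum_mono2) (auto intro!: less_imp_le)
  \<comment> \<open>Up to the factor \<open>- ln 2\<close> this sum is the mutual information of
    \<open>f\<close> and \<open>g\<close>, which \<open>eq\<close> makes zero.\<close>
  have "(\<Sum>s\<in>S. p s * ln (z s)) = 0"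
  proof -
    have "(\<Sum>s\<in>S. p s * ln (z s)) =
        ln 2 * (\<Sum>s\<in>S. p s * (log 2 (?m f s) + log 2 (?m g s) - log 2 (?m ?fg s)))"
      unfolding sum_distrib_left
    proof (rule sum.cong)
      fix s assume "s \<in> S"
      show "p s * ln (z s) = ln 2 * (p s * (log 2 (?m f s) + log 2 (?m g s) - log 2 (?m ?fg s)))"
        using pos[OF \<open>s \<in> S\<close>]
        by (simp add: z_def mF mG mJ log_def ln_div ln_mult field_simps)
    qed simp
    also have "\<dots> = 0"
      using eq by (simp add: fiber_entropy_def sum_subtractf sum.distrib algebra_simps)
    finally show ?thesis .
  qed
  moreover have "(\<Sum>s\<in>S. p s * (z s - 1 - ln (z s))) =
      (\<Sum>s\<in>S. p s * z s) - 1 - (\<Sum>s\<in>S. p s * ln (z s))"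
    using sum_p by (simp add: right_diff_distrib sum_subtractf)
  moreover have term_nonneg: "0 \<le> p s * (z s - 1 - ln (z s))" if "s \<in> S" for s
    using p_pos[OF that] ln_le_minus_one[OF zpos[OF that]] by simp
  \<comment> \<open>A sum of nonnegative terms equals the expectation of \<open>z\<close> minus 1,
    which is at most 0; so both are 0.\<close>
  ultimately have total: "(\<Sum>s\<in>S. p s * z s) = 1" and "(\<Sum>s\<in>S. p s * (z s - 1 - ln (z s))) = 0"
    using sumz_le sumz sum_nonneg[of S "\<lambda>s. p s * (z s - 1 - ln (z s))"] by auto
  then have zero: "p s * (z s - 1 - ln (z s)) = 0" if "s \<in> S" for s
    using that finite_S term_nonneg by (simp add: sum_nonneg_eq_0_iff)
  show "?m ?fg s = ?m f s * ?m g s" if "s \<in> S" for s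
  proof -
    have "ln (z s) = z s - 1" using zero[OF that] p_pos[OF that] by simp
    then have "z s = 1" using zpos[OF that] by (simp add: ln_eq_minus_one)
    then show ?thesis using pos[OF that] by (simp add: z_def mF mG mJ)
  qed
  show "\<exists>u\<in>S. f u = f s \<and> g u = g t" if st: "s \<in> S" "t \<in> S"
  proof (rule ccontr)
    assume "\<not> ?thesis"
    \<comment> \<open>A pair that never occurs still has positive product mass, which would leave
      less than 1 for the pairs that do occur.\<close>
    then have "(f s, g t) \<in> f ` S \<times> g ` S - ?fg ` S" using st by auto
    then have "(\<Sum>(x,y)\<in>?fg ` S. F x * G y) < (\<Sum>(x,y)\<in>f ` S \<times> g ` S. F x * G y)"
      using finite_S sub FGpos
      by (intro sum_strict_mono2[where b = "(f s, g t)"]) (auto intro!: less_imp_le)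
    then show False using total sumz prod1 by simp
  qed
qed

text \<open>The hypotheses encode, through entropies alone, pairwise independence of
  \<open>f\<close>, \<open>g\<close>, \<open>h\<close> and that any two determine the third. The
  mass of a triple is then a product of two marginals in three ways, and cancelling positive factors
  equates the marginals.\<close>

lemma fiber_mass_uniform:
  fixes f g h :: "'a \<Rightarrow> 'b"
  assumes H: "fiber_entropy S p f = c" "fiber_entropy S p g = c" "fiber_entropy S p h = c"
    and H2: "fiber_entropy S p (\<lambda>s. (f s, g s)) = 2 * c" "fiber_entropy S p (\<lambda>s. (f s, h s)) = 2 * c"
      "fiber_entropy S p (\<lambda>s. (g s, h s)) = 2 * c"
    and H3: "fiber_entropy S p (\<lambda>s. (f s, g s, h s)) = 2 * c"
    and s: "s \<in> S"
  shows "fiber_mass S p f s = 1 / real (card (f ` S))"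
proof -
  let ?m = "fiber_mass S p"
  have eqs: "?m f u * ?m g u = ?m f u * ?m h u" "?m f u * ?m g u = ?m g u * ?m h u" if u: "u \<in> S" for u
  proof -
    let ?J = "?m (\<lambda>s. (f s, g s, h s)) u"
    have "?J = ?m (\<lambda>s. (f s, g s)) u"
      using H2(1) H3 u by (intro fiber_mass_eq_of_entropy_eq) auto
    then have 1: "?J = ?m f u * ?m g u"
      using fiber_mass_pair_eq[of f g u] H H2 u by simp
    have "?J = ?m (\<lambda>s. (f s, h s)) u"
      using H2(2) H3 u by (intro fiber_mass_eq_of_entropy_eq) auto
    then have 2: "?J = ?m f u * ?m h u"
      using fiber_mass_pair_eq[of f h u] H H2 u by simp
    have "?J = ?m (\<lambda>s. (g s, h s)) u"
      using H2(3) H3 u by (intro fiber_mass_eq_of_entropy_eq) auto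
    then have 3: "?J = ?m g u * ?m h u"
      using fiber_mass_pair_eq[of g h u] H H2 u by simp
    show "?m f u * ?m g u = ?m f u * ?m h u" "?m f u * ?m g u = ?m g u * ?m h u"
      using 1 2 3 by metis+
  qed
  have fg: "?m f u = ?m g u" if u: "u \<in> S" for u
    using eqs[OF u] fiber_mass_pos[OF u, of f] fiber_mass_pos[OF u, of g] by auto
  have const: "?m f t = ?m f s" if t: "t \<in> S" for t
  proof -
    \<comment> \<open>The outcome \<open>u\<close> links \<open>s\<close> and \<open>t\<close>: it
      shares its \<open>f\<close>-value with \<open>s\<close> and its \<open>g\<close>-value with
      \<open>t\<close>, and at \<open>u\<close> the two masses agree.\<close>
    obtain u where u: "u \<in> S" "f u = f s" "g u = g t"
      using fiber_pair_surj[of f g s t] H H2 s t by auto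
    have "?m f t = ?m g u" using fg[OF t] u(3) by (simp add: fiber_mass_def)
    also have "\<dots> = ?m f s" using fg[OF u(1)] u(2) by (simp add: fiber_mass_def)
    finally show ?thesis .
  qed
  have "1 = (\<Sum>x\<in>f ` S. \<Sum>t\<in>{t\<in>S. f t = x}. p t)"
    using sum_over_fibers[of "\<lambda>_. 1" f] sum_p by simp
  also have "\<dots> = (\<Sum>x\<in>f ` S. ?m f s)"
  proof (rule sum.cong)
    fix x assume "x \<in> f ` S"
    then obtain t where "t \<in> S" "x = f t" by auto
    then show "(\<Sum>t\<in>{t\<in>S. f t = x}. p t) = ?m f s"
      using const[of t] by (simp add: fiber_mass_def)
  qed simp
  finally have "1 = real (card (f ` S)) * ?m f s" by simp
  then show ?thesis by (metis mult_zero_left nonzero_eq_divide_eq mult.commute zero_neq_one)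
qed

end

section \<open>Partitions of an integer as fiber sizes of a map\<close>

text \<open>The entropy of \<open>g\<close> under the uniform distribution on \<open>D\<close>,
  averaged over points. Both directions of the theorem compare \<open>a\<close> with this
  quantity.\<close>

definition class_entropy :: "'a set \<Rightarrow> ('a \<Rightarrow> 'b) \<Rightarrow> real" where
  "class_entropy D g =
    - (\<Sum>x\<in>D. log 2 (real (card {y\<in>D. g y = g x}) / real (card D))) / real (card D)"

text \<open>A class of size k accounts for k equal terms of the average over \<open>D\<close>, so
  summing over classes or over points gives the same result. The list \<open>ys\<close> only fixes
  an order of the classes.\<close>

lemma prob_entropy_class_sizes:
  assumes D: "finite D" and ys: "distinct ys" "set ys = g ` D"
  shows "prob_entropy (map (\<lambda>x. real x / real (card D)) (map (\<lambda>y. card {x\<in>D. g x = y}) ys)) =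
    class_entropy D g"
proof -
  let ?v = "real (card D)" and ?k = "\<lambda>y. real (card {x\<in>D. g x = y})"
  have "(\<Sum>i<length ys. ?k (ys ! i) / ?v * log 2 (?k (ys ! i) / ?v)) =
      (\<Sum>y\<in>g ` D. ?k y / ?v * log 2 (?k y / ?v))"
    using ys bij_betw_nth[of ys "{..<length ys}" "g ` D"]
    by (intro sum.reindex_bij_betw) auto
  also have "\<dots> = (\<Sum>y\<in>g ` D. \<Sum>x\<in>{x\<in>D. g x = y}. log 2 (?k (g x) / ?v) / ?v)"
    by (rule sum.cong) auto
  also have "\<dots> = (\<Sum>x\<in>D. log 2 (?k (g x) / ?v) / ?v)"
    using D by (intro sum.group) auto
  finally show ?thesis
    by (simp add: prob_entropy_def class_entropy_def sum_divide_distrib)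
qed

lemma int_partition_class_sizes:
  assumes D: "finite D" "D \<noteq> {}" and ys: "distinct ys" "set ys = g ` D"
  shows "int_partition (card D) (map (\<lambda>y. card {x\<in>D. g x = y}) ys)"
proof -
  have "sum_list (map (\<lambda>y. card {x\<in>D. g x = y}) ys) = (\<Sum>y\<in>g ` D. \<Sum>x\<in>{x\<in>D. g x = y}. 1)"
    using ys by (simp add: sum_list_distinct_conv_sum_set)
  also have "\<dots> = card D"
    using D by (subst sum.group) auto
  moreover have "length ys = card (g ` D)" using ys distinct_card by metis
  then have "length ys \<le> card D" "ys \<noteq> []" using D ys card_image_le by auto
  ultimately show ?thesis
    using D ys unfolding int_partition_def by (auto simp: card_gt_0_iff Suc_le_eq)
qed

text \<open>The disjoint union of blocks of sizes \<open>\<alpha> ! i\<close> has \<open>v\<close>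
  elements; numbering it by \<open>{..<v}\<close> and reading off the block index gives
  \<open>g\<close>.\<close>

lemma int_partition_realize:
  assumes "int_partition v \<alpha>"
  obtains g :: "nat \<Rightarrow> nat" where "\<alpha> = map (\<lambda>y. card {x\<in>{..<v}. g x = y}) [0..<length \<alpha>]"
    and "set [0..<length \<alpha>] = g ` {..<v}"
proof -
  let ?B = "SIGMA i:{..<length \<alpha>}. {..<\<alpha> ! i}"
  have "card ?B = v"
    using assms by (simp add: int_partition_def sum_list_sum_nth atLeast0LessThan)
  then obtain e where e: "bij_betw e {..<v} ?B"
    using ex_bij_betw_nat_finite[of ?B] by (auto simp: atLeast0LessThan)
  define g where "g x = fst (e x)" for x
  have "card {x\<in>{..<v}. g x = i} = \<alpha> ! i" if "i < length \<alpha>" for i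
  proof -
    have "bij_betw e {x\<in>{..<v}. g x = i} ({i} \<times> {..<\<alpha> ! i})"
      unfolding bij_betw_def
    proof
      show "inj_on e {x\<in>{..<v}. g x = i}"
        using e by (auto simp: bij_betw_def intro: inj_on_subset)
      have "e ` {x\<in>{..<v}. g x = i} = {w\<in>e ` {..<v}. fst w = i}" by (auto simp: g_def)
      then show "e ` {x\<in>{..<v}. g x = i} = {i} \<times> {..<\<alpha> ! i}"
        using e that by (auto simp: bij_betw_def)
    qed
    then show ?thesis by (auto dest: bij_betw_same_card simp: card_cartesian_product)
  qed
  moreover have "g ` {..<v} = {..<length \<alpha>}"
  proof -
    have "g ` {..<v} = fst ` ?B" using e by (auto simp: g_def bij_betw_def simp flip: image_image)
    \<comment> \<open>The parts are positive, so no block is empty and every index is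
      attained.\<close>
    also have "\<dots> = {..<length \<alpha>}"
      using assms by (force simp: int_partition_def image_iff)
    finally show ?thesis .
  qed
  ultimately show ?thesis
    by (intro that[of g]) (auto intro!: nth_equalityI simp: atLeast0LessThan)
qed

section \<open>From entropic points to partitions\<close>

text \<open>Every subvector is a restriction of the full vector \<open>T\<close>, so the entropies
  for all \<open>A\<close> become fiber entropies over one common support.\<close>

lemma joint_entropy_eq_fiber_entropy:
  assumes M: "prob_space M" and X: "\<And>j. j \<in> N4 \<Longrightarrow> simple_function M (X j)" and A: "A \<subseteq> N4"
  defines "T \<equiv> \<lambda>\<omega>. \<lambda>j\<in>N4. X j \<omega>"
  defines "p \<equiv> \<lambda>t. measure M (T -` {t} \<inter> space M)"
  defines "S \<equiv> {t \<in> T ` space M. 0 < p t}"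
  shows "joint_entropy M X A = fiber_entropy S p (\<lambda>t. restrict t A)"
proof -
  have T: "simple_function M T"
    unfolding T_def by (rule simple_function_restrict) (auto simp: N4_def intro: X[unfolded N4_def])
  have "(\<lambda>\<omega>. \<lambda>j\<in>A. X j \<omega>) = (\<lambda>\<omega>. restrict (T \<omega>) A)"
    using A by (auto simp: T_def fun_eq_iff restrict_def)
  then show ?thesis
    unfolding joint_entropy_def S_def p_def
    by (simp only: entropy_compose_eq_fiber_entropy[OF M T, of "\<lambda>t. restrict t A"])
qed

lemma restrict_eq_iff: "restrict s A = restrict t A \<longleftrightarrow> (\<forall>j\<in>A. s j = t j)"
  by (auto simp: fun_eq_iff restrict_def)

lemma W2_rank_not_subset:
  "3 \<in> A \<or> 4 \<in> A \<Longrightarrow> W2_rank A = (if card A = 1 then 1 else 2)"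
  by (auto simp: W2_rank_def)

lemma entropic_imp_partition:
  assumes "entropic (face_point W2_rank U23_rank a b)"
  shows "\<exists>v \<alpha>. 1 \<le> v \<and> int_partition v \<alpha> \<and> a + b = log 2 (real v) \<and>
    a = prob_entropy (map (\<lambda>x. real x / real v) \<alpha>)"
proof -
  obtain M :: "nat measure" and X :: "nat \<Rightarrow> nat \<Rightarrow> nat"
    where M: "prob_space M" and X: "\<And>j. j \<in> N4 \<Longrightarrow> simple_function M (X j)"
      and h: "\<And>A. A \<subseteq> N4 \<Longrightarrow> face_point W2_rank U23_rank a b A = joint_entropy M X A"
    using assms unfolding entropic_def by blast
  define T where "T = (\<lambda>\<omega>. \<lambda>j\<in>N4. X j \<omega>)"
  define p where "p = (\<lambda>t. measure M (T -` {t} \<inter> space M))"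
  define S where "S = {t \<in> T ` space M. 0 < p t}"
  have T: "simple_function M T"
    unfolding T_def by (rule simple_function_restrict) (auto simp: N4_def intro: X[unfolded N4_def])
  interpret positive_weights S p
  proof
    show "finite S" using simple_functionD(1)[OF T] by (simp add: S_def)
    show "0 < p s" if "s \<in> S" for s using that by (simp add: S_def)
    show "sum p S = 1" unfolding S_def p_def using sum_support_eq_1[OF M T] .
  qed
  let ?H = "fiber_entropy S p"
  \<comment> \<open>Any \<open>f\<close> with the same fibers as the restriction to \<open>A\<close>
    is allowed, so that coordinates and tuples can be used below.\<close>
  have H: "?H f = a * W2_rank A + b * U23_rank A"
    if "A \<subseteq> N4" and "\<And>s t. f s = f t \<longleftrightarrow> (\<forall>j\<in>A. s j = t j)" for A and f :: "(nat \<Rightarrow> nat) \<Rightarrow> 'c"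
  proof -
    have "?H f = ?H (\<lambda>t. restrict t A)"
      by (rule fiber_entropy_cong) (simp add: that(2) restrict_eq_iff)
    also have "\<dots> = joint_entropy M X A"
      unfolding S_def p_def T_def using joint_entropy_eq_fiber_entropy[OF M X that(1)] by simp
    finally show ?thesis using h[OF that(1)] by (simp add: face_point_def)
  qed
  have H1: "?H (\<lambda>t. t 1) = a + b" and H2: "?H (\<lambda>t. t 2) = a"
    and H3: "?H (\<lambda>t. t 3) = a + b" and H4: "?H (\<lambda>t. t 4) = a + b"
    using H[of "{1}" "\<lambda>t. t 1"] H[of "{2}" "\<lambda>t. t 2"] H[of "{3}" "\<lambda>t. t 3"] H[of "{4}" "\<lambda>t. t 4"]
    by (simp_all add: N4_def W2_rank_def U23_rank_def)
  have H12: "?H (\<lambda>t. (t 1, t 2)) = a + b"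
    using H[of "{1, 2}" "\<lambda>t. (t 1, t 2)"] by (simp add: N4_def W2_rank_def U23_rank_def)
  have H13: "?H (\<lambda>t. (t 1, t 3)) = 2 * (a + b)" and H14: "?H (\<lambda>t. (t 1, t 4)) = 2 * (a + b)"
    and H34: "?H (\<lambda>t. (t 3, t 4)) = 2 * (a + b)" and H134: "?H (\<lambda>t. (t 1, t 3, t 4)) = 2 * (a + b)"
    using H[of "{1, 3}" "\<lambda>t. (t 1, t 3)"] H[of "{1, 4}" "\<lambda>t. (t 1, t 4)"]
      H[of "{3, 4}" "\<lambda>t. (t 3, t 4)"] H[of "{1, 3, 4}" "\<lambda>t. (t 1, t 3, t 4)"]
    by (simp_all add: N4_def W2_rank_not_subset U23_rank_def)
  define D where "D = (\<lambda>t. t 1) ` S"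
  \<comment> \<open>The choice made by \<open>inv_into\<close> is harmless: the sets
    \<open>{1}\<close> and \<open>{1, 2}\<close> have equal entropy, so the first coordinate
    determines the second on \<open>S\<close>.\<close>
  define g where "g = (\<lambda>x. inv_into S (\<lambda>t. t 1) x 2)"
  let ?v = "card D"
  have D: "finite D" "D \<noteq> {}" using finite_S nonempty by (auto simp: D_def)
  have mass1: "fiber_mass S p (\<lambda>t. t 1) s = 1 / real ?v" if "s \<in> S" for s
    unfolding D_def
    using fiber_mass_uniform[OF H1 H3 H4 H13 H14 H34 H134 that] .
  have g: "g (s 1) = s 2" if "s \<in> S" for s
  proof -
    let ?s = "inv_into S (\<lambda>t. t 1) (s 1)"
    have "s 1 \<in> (\<lambda>t. t 1) ` S" using that by blast
    then have "?s \<in> S" "?s 1 = s 1"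
      by (fact inv_into_into, fact f_inv_into_f[of _ "\<lambda>t. t 1"])
    moreover from this have "(?s 1, ?s 2) = (s 1, s 2)"
      using fiber_eq_of_entropy_eq[of "\<lambda>t. (t 1, t 2)" "\<lambda>t. t 1" ?s s] H1 H12 that by simp
    ultimately show ?thesis by (simp add: g_def)
  qed
  have fiber1: "(\<Sum>t\<in>{t\<in>S. t 1 = x}. p t) = 1 / real ?v" if "x \<in> D" for x
    using that mass1 by (auto simp: D_def fiber_mass_def)
  have mass2: "fiber_mass S p (\<lambda>t. t 2) s = real (card {x\<in>D. g x = g (s 1)}) / real ?v" if s: "s \<in> S" for s
  proof -
    let ?E = "{t\<in>S. t 2 = s 2}" and ?C = "{x\<in>D. g x = g (s 1)}"
    \<comment> \<open>The event splits by the value of the first coordinate into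
      \<open>card ?C\<close> pieces, each of mass \<open>1 / real ?v\<close>.\<close>
    have "sum p ?E = (\<Sum>x\<in>?C. sum p {t\<in>?E. t 1 = x})"
      using finite_S D s g by (intro sum.group[symmetric]) (auto simp: D_def)
    also have "\<dots> = (\<Sum>x\<in>?C. 1 / real ?v)"
    proof (rule sum.cong)
      fix x assume x: "x \<in> ?C"
      have "{t\<in>?E. t 1 = x} = {t\<in>S. t 1 = x}"
        using x s g by fastforce
      then show "sum p {t\<in>?E. t 1 = x} = 1 / real ?v" using fiber1 x by simp
    qed simp
    finally show ?thesis by (simp add: fiber_mass_def)
  qed
  have ab: "a + b = log 2 (real ?v)"
  proof -
    have "a + b = - (\<Sum>s\<in>S. p s * log 2 (1 / real ?v))"
      unfolding H1[symmetric] fiber_entropy_def by (simp add: mass1[simplified])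
    also have "\<dots> = log 2 (real ?v)"
      using D by (simp add: sum_distrib_right[symmetric] sum_p log_divide card_gt_0_iff sum_negf)
    finally show ?thesis .
  qed
  have a: "a = class_entropy D g"
  proof -
    have "a = - (\<Sum>s\<in>S. p s * log 2 (real (card {x\<in>D. g x = g (s 1)}) / real ?v))"
      unfolding H2[symmetric] fiber_entropy_def by (simp add: mass2)
    \<comment> \<open>Pushed forward to the first coordinate, the weights become uniform, which
      turns the expectation into the average in \<open>class_entropy\<close>.\<close>
    also have "\<dots> = - (\<Sum>y\<in>D. (\<Sum>t\<in>{t\<in>S. t 1 = y}. p t) * log 2 (real (card {x\<in>D. g x = g y}) / real ?v))"
      unfolding D_def by (rule arg_cong[where f = uminus]) (rule sum_over_fibers)
    also have "\<dots> = class_entropy D g"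
      by (simp add: fiber1[simplified] class_entropy_def sum_divide_distrib)
    finally show ?thesis .
  qed
  obtain ys where ys: "distinct ys" "set ys = g ` D"
    using finite_distinct_list[of "g ` D"] D by auto
  show ?thesis
    using D ab a prob_entropy_class_sizes[OF D(1) ys] int_partition_class_sizes[OF D ys]
    by (intro exI[of _ ?v] exI[of _ "map (\<lambda>y. card {x\<in>D. g x = y}) ys"])
      (auto simp: Suc_le_eq card_gt_0_iff)
qed

section \<open>From partitions to entropic points\<close>

lemma entropy_uniform_count_measure:
  assumes \<Omega>: "finite \<Omega>" "\<Omega> \<noteq> {}"
  shows "prob_space.entropy (uniform_count_measure \<Omega>) 2 (count_space (f ` \<Omega>)) f = class_entropy \<Omega> f"
proof -
  let ?M = "uniform_count_measure \<Omega>"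
  have M: "prob_space ?M" using \<Omega> by (rule prob_space_uniform_count_measure)
  have T: "simple_function ?M (\<lambda>\<omega>. \<omega>)"
    using \<Omega> by (simp add: simple_function_def space_uniform_count_measure sets_uniform_count_measure)
  have p: "measure ?M ((\<lambda>\<omega>. \<omega>) -` {t} \<inter> space ?M) = 1 / card \<Omega>" if "t \<in> \<Omega>" for t
    using that \<Omega> by (simp add: space_uniform_count_measure measure_uniform_count_measure)
  have S: "{t \<in> (\<lambda>\<omega>. \<omega>) ` space ?M. 0 < measure ?M ((\<lambda>\<omega>. \<omega>) -` {t} \<inter> space ?M)} = \<Omega>"
    using \<Omega> p by (auto simp: space_uniform_count_measure card_gt_0_iff)
  have "prob_space.entropy ?M 2 (count_space (f ` \<Omega>)) f =
      fiber_entropy \<Omega> (\<lambda>t. measure ?M ((\<lambda>\<omega>. \<omega>) -` {t} \<inter> space ?M)) f"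
    using entropy_compose_eq_fiber_entropy[OF M T, of f] unfolding S
    by (simp add: space_uniform_count_measure)
  also have "\<dots> = class_entropy \<Omega> f"
    unfolding fiber_entropy_def class_entropy_def fiber_mass_def using p
    by (simp add: sum_divide_distrib)
  finally show ?thesis .
qed

text \<open>With c the size of the \<open>g\<close>-class and v that of \<open>D\<close>, a fiber
  has relative size m c / v^2 = (c / v) / (v / m), so the logarithm splits. This reduces each
  entropy of the construction to a count.\<close>

lemma class_entropy_Times:
  assumes D: "finite D" and m: "0 < m"
    and eq: "\<And>x y. x \<in> D \<Longrightarrow> y \<in> D \<Longrightarrow>
      card {t\<in>D \<times> D. f t = f (x, y)} = m * card {x'\<in>D. g x' = g x}"
  shows "class_entropy (D \<times> D) f = class_entropy D g + log 2 (real (card D) / real m)"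
proof (cases "D = {}")
  \<comment> \<open>Both class entropies are empty sums, and \<open>log 2 0\<close> is 0.\<close>
  case True
  then show ?thesis by (simp add: class_entropy_def log_def)
next
  case False
  let ?v = "real (card D)" and ?c = "\<lambda>x. real (card {x'\<in>D. g x' = g x})"
  have v: "0 < ?v" using D False by (simp add: card_gt_0_iff)
  have c: "0 < ?c x" if "x \<in> D" for x using D that by (auto simp: card_gt_0_iff)
  have "(\<Sum>t\<in>D \<times> D. log 2 (real (card {t'\<in>D \<times> D. f t' = f t}) / real (card (D \<times> D)))) =
      (\<Sum>x\<in>D. \<Sum>y\<in>D. log 2 (?c x / ?v) - log 2 (?v / real m))"
    unfolding sum.cartesian_product
  proof (rule sum.cong)
    fix t assume t: "t \<in> D \<times> D"
    obtain x y where xy: "t = (x, y)" "x \<in> D" "y \<in> D" using t by auto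
    have "real (card {t'\<in>D \<times> D. f t' = f t}) / real (card (D \<times> D)) = (?c x / ?v) / (?v / real m)"
      unfolding xy(1) eq[OF xy(2,3)] by (simp add: card_cartesian_product)
    moreover have "log 2 ((?c x / ?v) / (?v / real m)) = log 2 (?c x / ?v) - log 2 (?v / real m)"
      using v c[OF xy(2)] m by (subst log_divide) auto
    ultimately have "log 2 (real (card {t'\<in>D \<times> D. f t' = f t}) / real (card (D \<times> D))) =
        log 2 (?c x / ?v) - log 2 (?v / real m)"
      by simp
    then show "log 2 (real (card {t'\<in>D \<times> D. f t' = f t}) / real (card (D \<times> D))) =
        (case t of (x, y) \<Rightarrow> log 2 (?c x / ?v) - log 2 (?v / real m))"
      by (simp add: xy(1))
  qed simp
  also have "\<dots> = ?v * (\<Sum>x\<in>D. log 2 (?c x / ?v)) - ?v * ?v * log 2 (?v / real m)"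
    by (simp add: sum_subtractf sum_distrib_left right_diff_distrib)
  finally show ?thesis
    using v by (simp add: class_entropy_def card_cartesian_product field_simps)
qed

lemma class_entropy_const: "finite D \<Longrightarrow> class_entropy D (\<lambda>_. c) = 0"
  by (cases "D = {}") (simp_all add: class_entropy_def)

lemma class_entropy_id:
  assumes "finite D" "D \<noteq> {}"
  shows "class_entropy D (\<lambda>x. x) = log 2 (real (card D))"
proof -
  have "{y\<in>D. y = x} = {x}" if "x \<in> D" for x using that by auto
  then show ?thesis
    using assms by (simp add: class_entropy_def log_divide card_gt_0_iff)
qed

text \<open>For each \<open>x\<close> exactly one \<open>y\<close> solves \<open>Z x y = k\<close>,
  so projecting to \<open>x\<close> is a bijection. It is applied to addition modulo
  \<open>v\<close> and to the plain second coordinate.\<close>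

lemma card_latin_fiber:
  assumes bij: "\<And>x. x \<in> D \<Longrightarrow> bij_betw (Z x) D D" and "k \<in> D"
  shows "card {t\<in>D \<times> D. P (fst t) \<and> Z (fst t) (snd t) = k} = card {x\<in>D. P x}"
proof -
  have "bij_betw fst {t\<in>D \<times> D. P (fst t) \<and> Z (fst t) (snd t) = k} {x\<in>D. P x}"
    unfolding bij_betw_def
  proof
    show "inj_on fst {t\<in>D \<times> D. P (fst t) \<and> Z (fst t) (snd t) = k}"
    proof (rule inj_onI)
      fix s t assume st: "s \<in> {t\<in>D \<times> D. P (fst t) \<and> Z (fst t) (snd t) = k}"
        "t \<in> {t\<in>D \<times> D. P (fst t) \<and> Z (fst t) (snd t) = k}" "fst s = fst t"
      then have "snd s = snd t"
        using inj_onD[OF bij_betw_imp_inj_on[OF bij], of "fst t" "snd s" "snd t"] by auto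
      then show "s = t" using st(3) by (simp add: prod_eq_iff)
    qed
    have "\<exists>y\<in>D. Z x y = k" if "x \<in> D" for x
      using bij_betw_imp_surj_on[OF bij[OF that]] \<open>k \<in> D\<close> by (metis image_iff)
    then show "fst ` {t\<in>D \<times> D. P (fst t) \<and> Z (fst t) (snd t) = k} = {x\<in>D. P x}"
      by (force simp: image_iff)
  qed
  then show ?thesis by (rule bij_betw_same_card)
qed

lemma partition_imp_entropic:
  assumes v: "1 \<le> v" and part: "int_partition v \<alpha>" and ab: "a + b = log 2 (real v)"
    and a: "a = prob_entropy (map (\<lambda>x. real x / real v) \<alpha>)"
  shows "entropic (face_point W2_rank U23_rank a b)"
proof -
  define D where "D = {..<v}"
  have D: "finite D" "D \<noteq> {}" "card D = v" using v by (auto simp: D_def lessThan_empty_iff)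
  obtain g :: "nat \<Rightarrow> nat" where g: "\<alpha> = map (\<lambda>y. card {x\<in>D. g x = y}) [0..<length \<alpha>]"
    "set [0..<length \<alpha>] = g ` D"
    using int_partition_realize[OF part] unfolding D_def by blast
  have ag: "a = class_entropy D g"
    using prob_entropy_class_sizes[OF D(1) distinct_upt g(2)] a g(1) D(3) by simp
  \<comment> \<open>Addition modulo \<open>v\<close>: on \<open>D\<close> the sum stays below 2 v,
    so one subtraction suffices, and it is never truncated.\<close>
  define Z where "Z x y = (if x + y < v then x + y else x + y - v)" for x y
  have Zbij: "bij_betw (Z x) D D" if "x \<in> D" for x
  proof -
    have "inj_on (Z x) D" "Z x ` D \<subseteq> D"
      using that by (auto simp: inj_on_def Z_def D_def split: if_splits)
    then show ?thesis
      using D(1) by (simp add: bij_betw_def endo_inj_surj)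
  qed
  have ZD: "Z x y \<in> D" if "x \<in> D" "y \<in> D" for x y
    using bij_betwE[OF Zbij[OF that(1)]] that(2) by blast
  have Zinj: "x = x'" if "Z x y = Z x' y" "x \<in> D" "x' \<in> D" "y \<in> D" for x x' y
    using that by (auto simp: Z_def D_def split: if_splits)
  define X where "X j t = (if j = 1 then fst t else if j = 2 then g (fst t)
    else if j = 3 then snd t else Z (fst t) (snd t))" for j :: nat and t :: "nat \<times> nat"
  have X: "X 1 t = fst t" "X (Suc 0) t = fst t" "X 2 t = g (fst t)" "X 3 t = snd t"
    "X 4 t = Z (fst t) (snd t)" for t
    by (simp_all add: X_def)
  let ?\<Omega> = "D \<times> D"
  let ?M = "uniform_count_measure ?\<Omega>"
  have \<Omega>: "finite ?\<Omega>" "?\<Omega> \<noteq> {}" using D by auto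
  \<comment> \<open>Take \<open>m = v\<close> when \<open>X\<^sub>A\<close> depends on the first
    coordinate only, through \<open>G\<close>. Take \<open>m = 1\<close> when it also fixes the
    second coordinate or the sum; this adds log v, that is \<open>a + b\<close>.\<close>
  have joint: "joint_entropy ?M X A = class_entropy D G + log 2 (real v / real m)"
    if "0 < m" and "\<And>x y. x \<in> D \<Longrightarrow> y \<in> D \<Longrightarrow>
      card {t\<in>?\<Omega>. \<forall>j\<in>A. X j t = X j (x, y)} = m * card {x'\<in>D. G x' = G x}"
    for A m and G :: "nat \<Rightarrow> nat"
    unfolding joint_entropy_def space_uniform_count_measure entropy_uniform_count_measure[OF \<Omega>]
    using that D by (subst class_entropy_Times[where g = G and m = m]) (simp_all add: restrict_eq_iff)
  have first: "card {t\<in>?\<Omega>. P (fst t)} = v * card {x\<in>D. P x}" for P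
  proof -
    have "{t\<in>?\<Omega>. P (fst t)} = {x\<in>D. P x} \<times> D" by auto
    then show ?thesis using D by (simp add: card_cartesian_product)
  qed
  have second: "card {t\<in>?\<Omega>. P (fst t) \<and> snd t = y} = card {x\<in>D. P x}" if "y \<in> D" for P y
    using card_latin_fiber[of D "\<lambda>_ y. y"] D that by (simp add: bij_betw_def)
  have third: "card {t\<in>?\<Omega>. P (fst t) \<and> Z (fst t) (snd t) = z} = card {x\<in>D. P x}" if "z \<in> D" for P z
    using card_latin_fiber[OF Zbij that] .
  have v0: "log 2 (real v / real v) = 0" using v by simp
  have single: "card {x'\<in>D. x' = x} = 1" if "x \<in> D" for x
  proof -
    have "{x'\<in>D. x' = x} = {x}" using that by auto
    then show ?thesis by simp
  qed
  have const: "joint_entropy ?M X {} = 0"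
    using v first[of "\<lambda>_. True"] D v0 class_entropy_const[OF D(1), of "0::nat"]
    by (subst joint[of v _ "\<lambda>_. 0"]) (auto simp: card_cartesian_product)
  have one: "joint_entropy ?M X A = a + b" if "A = {1} \<or> A = {1, 2}" for A
  proof -
    have "(\<forall>j\<in>A. X j t = X j (x, y)) \<longleftrightarrow> fst t = x" for t x y
      using that by (auto simp: X)
    then show ?thesis
      using v v0 ab class_entropy_id[OF D(1,2)] D(3) first[of "\<lambda>x'. x' = x" for x]
      by (subst joint[of v _ "\<lambda>x. x"]) auto
  qed
  have two: "joint_entropy ?M X {2} = a"
    using v v0 ag first[of "\<lambda>x'. g x' = c" for c] by (subst joint[of v _ g]) (auto simp: X)
  have three: "joint_entropy ?M X {3} = a + b"
    using ab class_entropy_const[OF D(1), of "0::nat"] second[of _ "\<lambda>_. True"]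
    by (subst joint[of 1 _ "\<lambda>_. 0"]) (auto simp: X)
  have four: "joint_entropy ?M X {4} = a + b"
    using ab class_entropy_const[OF D(1), of "0::nat"] third[of _ "\<lambda>_. True"]
    by (subst joint[of 1 _ "\<lambda>_. 0"]) (auto simp: X ZD)
  have twothree: "joint_entropy ?M X {2, 3} = 2 * a + b"
    using ab ag second[of _ "\<lambda>x'. g x' = c" for c]
    by (subst joint[of 1 _ g]) (auto simp: X)
  have twofour: "joint_entropy ?M X {2, 4} = 2 * a + b"
    using ab ag third[of _ "\<lambda>x'. g x' = c" for c]
    by (subst joint[of 1 _ g]) (auto simp: X ZD)
  have full: "joint_entropy ?M X A = 2 * (a + b)" if "{1, 3} \<subseteq> A \<or> {1, 4} \<subseteq> A \<or> {3, 4} \<subseteq> A" for A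
  proof -
    have "card {t\<in>?\<Omega>. \<forall>j\<in>A. X j t = X j (x, y)} = 1 * card {x'\<in>D. x' = x}"
      if xy: "x \<in> D" "y \<in> D" for x y
    proof -
      have "t = (x, y)" if t: "t \<in> ?\<Omega>" "\<forall>j\<in>A. X j t = X j (x, y)" for t
      proof -
        have "1 \<in> A \<longrightarrow> fst t = x" "3 \<in> A \<longrightarrow> snd t = y" "4 \<in> A \<longrightarrow> Z (fst t) (snd t) = Z x y"
          using bspec[OF t(2), of 1] bspec[OF t(2), of 3] bspec[OF t(2), of 4] by (simp_all add: X)
        \<comment> \<open>Any two of the first coordinate, the second coordinate and their sum
          determine the outcome.\<close>
        then have "fst t = x \<and> snd t = y \<or> fst t = x \<and> Z (fst t) (snd t) = Z x y \<or>
            snd t = y \<and> Z (fst t) (snd t) = Z x y"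
          using \<open>{1, 3} \<subseteq> A \<or> {1, 4} \<subseteq> A \<or> {3, 4} \<subseteq> A\<close> by blast
        moreover have "snd t = y" if "fst t = x" "Z (fst t) (snd t) = Z x y"
          using inj_onD[OF bij_betw_imp_inj_on[OF Zbij[OF xy(1)]], of "snd t" y] that t(1) xy by auto
        moreover have "fst t = x" if "snd t = y" "Z (fst t) (snd t) = Z x y"
          using Zinj[of "fst t" y x] that t(1) xy by auto
        ultimately show ?thesis by (auto simp: prod_eq_iff)
      qed
      then have "{t\<in>?\<Omega>. \<forall>j\<in>A. X j t = X j (x, y)} = {(x, y)}" using xy by auto
      then show ?thesis using single[OF xy(1)] by simp
    qed
    then show ?thesis
      using ab class_entropy_id[OF D(1,2)] D(3) by (subst joint[of 1 _ "\<lambda>x. x"]) auto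
  qed
  show ?thesis
  proof (rule entropicI)
    show "prob_space ?M" using \<Omega> by (rule prob_space_uniform_count_measure)
    show "simple_function ?M (X j)" for j
      using \<Omega> by (auto simp: simple_function_def space_uniform_count_measure sets_uniform_count_measure)
    fix A assume "A \<subseteq> N4"
    \<comment> \<open>The sixteen subsets, grouped by the entropy computations above; the last group
      has entropy \<open>2 * (a + b)\<close>.\<close>
    moreover have "\<forall>A\<in>Pow {1, 2, 3, 4 :: nat}. A = {} \<or> (A = {1} \<or> A = {1, 2}) \<or> A = {2} \<or> A = {3} \<or>
        A = {4} \<or> A = {2, 3} \<or> A = {2, 4} \<or>
        A \<in> {{1,3}, {1,4}, {3,4}, {1,2,3}, {1,2,4}, {1,3,4}, {2,3,4}, {1,2,3,4}}"
      by (simp add: Pow_insert)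
    ultimately consider "A = {}" | "A = {1} \<or> A = {1, 2}" | "A = {2}" | "A = {3}" | "A = {4}"
      | "A = {2, 3}" | "A = {2, 4}" | "A \<in> {{1,3}, {1,4}, {3,4}, {1,2,3}, {1,2,4}, {1,3,4}, {2,3,4}, {1,2,3,4}}"
      unfolding N4_def Pow_iff[symmetric] by meson
    then show "face_point W2_rank U23_rank a b A = joint_entropy ?M X A"
    proof cases
      case 1 then show ?thesis by (simp add: const face_point_def W2_rank_def U23_rank_def)
    next
      case 2 then show ?thesis by (auto simp: one face_point_def W2_rank_def U23_rank_def)
    next
      case 3 then show ?thesis by (simp add: two face_point_def W2_rank_def U23_rank_def)
    next
      case 4 then show ?thesis by (simp add: three face_point_def W2_rank_def U23_rank_def)
    next
      case 5 then show ?thesis by (simp add: four face_point_def W2_rank_def U23_rank_def)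
    next
      case 6 then show ?thesis by (simp add: twothree face_point_def W2_rank_not_subset U23_rank_def)
    next
      case 7 then show ?thesis by (simp add: twofour face_point_def W2_rank_not_subset U23_rank_def)
    next
      case 8
      then have "face_point W2_rank U23_rank a b A = 2 * (a + b)"
        by (auto simp: face_point_def W2_rank_not_subset U23_rank_def)
      moreover have "joint_entropy ?M X A = 2 * (a + b)"
        by (rule full) (use 8 in auto)
      ultimately show ?thesis by simp
    qed
  qed
qed

theorem mainTheorem12:
  fixes a b :: real
  assumes "0 \<le> a" and "0 \<le> b"
  shows "entropic (face_point W2_rank U23_rank a b) \<longleftrightarrow>
    (\<exists>(v::nat) (\<alpha>::nat list). 1 \<le> v \<and> int_partition v \<alpha> \<and>
       a + b = log 2 (real v) \<and>
       a = prob_entropy (map (\<lambda>x. real x / real v) \<alpha>))"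
  using entropic_imp_partition partition_imp_entropic by blast

end
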